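(* Let $Q=-T\in\mathbb{R}^{N\times N}$, where $T_{ij}=-t_{ij}$ for $i\neq j$, $T_{ii}=\sum_{j\ne i}t_{ij}$, and $t_{ij}=t_{ji}\ge 0$ for all $i\ne j$. Let $H_n(s)$ be a nonzero real-rational strictly proper transfer function, let $\phi_n(s)=1/H_n(s)$, and define $\Omega_+:=\phi_n(\mathbb{C}_+)$ and $\Omega_+^c:=\mathbb{C}\setminus\Omega_+$. If all the non-zero eigenvalues of $Q$ lie in $\Omega_+^c$, then the nominal system $\Sigma(H_n(s),Q)$ is stable.
   Context: $\mathbb{C}_+=\{s\in\mathbb{C}:\mathrm{Re}\,s\ge 0\}$. $\phi_n(\mathbb{C}_+)$ is the set of finite values taken by the rational function $\phi_n$ on $\mathbb{C}_+$. $\Sigma(H_n(s),Q)$ denotes the homogeneous multi-agent feedback system $y=H_n(s)I_N\,u$, $u=Qy$. It is called stable if the rational function $\det(I_N-H_n(s)Q)$ has no zeros in $\mathbb{C}_+$; equivalently, $H_n(s)\lambda\neq 1$ for all eigenvalues $\lambda$ of $Q$ and all $s\in\mathbb{C}_+$ (where at a pole of $H_n$ the condition is regarded as satisfied). *)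

theory Defs
  imports
    Complex_Main
    "HOL-Computational_Algebra.Polynomial_Factorial"
    "HOL-Computational_Algebra.Field_as_Ring"
    "Jordan_Normal_Form.Determinant"
    "Jordan_Normal_Form.Char_Poly"
begin

text \<open>
  Real-rational functions are elements of the field of fractions of \<open>real poly\<close>.
  The pair returned by \<open>quot_of_fract\<close> is coprime, so the poles and zeros below are taken
  after all common factors have been cancelled. In particular, the zero function is
  represented by \<open>(0, 1)\<close>, and every point counts as a zero of it.
\<close>

type_synonym real_rational = "real poly fract"

definition rat_num :: "real_rational \<Rightarrow> complex poly" where
  "rat_num R = map_poly complex_of_real (fst (quot_of_fract R))"

definition rat_den :: "real_rational \<Rightarrow> complex poly" where
  "rat_den R = map_poly complex_of_real (snd (quot_of_fract R))"

definition rat_pole :: "real_rational \<Rightarrow> complex \<Rightarrow> bool" where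
  "rat_pole R s \<longleftrightarrow> poly (rat_den R) s = 0"

definition rat_zero :: "real_rational \<Rightarrow> complex \<Rightarrow> bool" where
  "rat_zero R s \<longleftrightarrow> poly (rat_num R) s = 0"

text \<open>This is the value of \<open>R\<close> at \<open>s\<close> only when \<open>s\<close> is not a pole of \<open>R\<close>.\<close>

definition rat_eval :: "real_rational \<Rightarrow> complex \<Rightarrow> complex" where
  "rat_eval R s = poly (rat_num R) s / poly (rat_den R) s"

definition rat_const :: "real \<Rightarrow> real_rational" where
  "rat_const c = to_fract [:c:]"

text \<open>
  The zero function has degrees \<open>0\<close> and \<open>0\<close> here and so does not satisfy this predicate;
  it is only meant for nonzero transfer functions.
\<close>

definition strictly_proper :: "real_rational \<Rightarrow> bool" where
  "strictly_proper R \<longleftrightarrow> degree (rat_num R) < degree (rat_den R)"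

definition closed_right_half_plane :: "complex set" where
  "closed_right_half_plane = {s. Re s \<ge> 0}"

definition finite_values_on :: "real_rational \<Rightarrow> complex set \<Rightarrow> complex set" where
  "finite_values_on R S = {rat_eval R s | s. s \<in> S \<and> \<not> rat_pole R s}"

text \<open>
  Stability of the interconnection of \<open>y = H I u\<close> with \<open>u = Q y\<close>, for a square matrix \<open>Q\<close>.
  The determinant is formed over the field of real-rational functions.
\<close>

definition stable_system :: "real_rational \<Rightarrow> real mat \<Rightarrow> bool" where
  "stable_system H Q \<longleftrightarrow>
     (\<forall>s\<in>closed_right_half_plane.
        \<not> rat_zero (det (1\<^sub>m (dim_row Q) - H \<cdot>\<^sub>m map_mat rat_const Q)) s)"

end

theory Submission
  imports Defs
begin

text \<open>
  Factor the characteristic polynomial of \<open>Q\<close> as \<open>X ^ m * g\<close> with \<open>g\<close> of degree \<open>d\<close> and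
  \<open>g 0 \<noteq> 0\<close>. Over the rational functions, \<open>det (1 - H Q) = H ^ d * g (1 / H)\<close>, so writing \<open>H = a / b\<close>
  in lowest terms turns the numerator into the homogenization of \<open>g\<close> at \<open>(b, a)\<close>. Where \<open>a\<close> vanishes,
  this homogenization is nonzero because \<open>g\<close> is monic. Elsewhere its zeros are the points where
  \<open>1 / H\<close> equals a nonzero eigenvalue of \<open>Q\<close>. Poles of \<open>H\<close> need no separate treatment: there
  \<open>b / a = 0\<close>, which is not a root of \<open>g\<close>.
\<close>

abbreviation cpoly :: "real poly \<Rightarrow> complex poly" where
  "cpoly \<equiv> map_poly complex_of_real"

interpretation cpoly_hom: map_poly_comm_ring_hom complex_of_real ..

interpretation rat_const_hom: inj_comm_ring_hom rat_const
proof unfold_locales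
  fix x y :: real
  show "rat_const (x + y) = rat_const x + rat_const y"
    by (simp add: rat_const_def flip: to_fract_add)
  show "rat_const (x * y) = rat_const x * rat_const y"
    by (simp add: rat_const_def flip: to_fract_mult)
  show "rat_const x = 0 \<Longrightarrow> x = 0"
    by (simp add: rat_const_def)
qed (simp_all add: rat_const_def flip: one_pCons)

text \<open>Coprimality over the reals already excludes common complex zeros: a Bezout identity of
  real polynomials survives the embedding into complex polynomials, where evaluating it at
  \<open>s\<close> would give 0 = 1.\<close>

lemma rat_num_den_no_common_zero:
  assumes "poly (rat_num R) s = 0" "poly (rat_den R) s = 0"
  shows False
proof -
  define p q where "p = fst (quot_of_fract R)" and "q = snd (quot_of_fract R)"
  have "coprime p q"
    unfolding p_def q_def by (rule coprime_quot_of_fract)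
  then obtain u v where "u * p + v * q = 1"
    using bezout_coefficients_fst_snd[of p q] by (metis coprime_imp_gcd_eq_1)
  then have "poly (cpoly (u * p + v * q)) s = 1" by simp
  then show False
    using assms by (simp add: cpoly_hom.hom_add cpoly_hom.hom_mult p_def q_def rat_num_def rat_den_def)
qed

text \<open>Transfers any representation of \<open>R\<close> as a fraction to its reduced form.
  Cross-multiplied, the identity can be evaluated at every point, including zeros of
  \<open>q\<close>.\<close>

lemma rat_num_den_cross:
  assumes "R * to_fract q = to_fract p"
  shows "rat_num R * cpoly q = cpoly p * rat_den R"
proof -
  define n d where "n = fst (quot_of_fract R)" and "d = snd (quot_of_fract R)"
  have "R = to_fract n / to_fract d" "d \<noteq> 0"
    by (simp_all add: n_def d_def flip: Fract_conv_to_fract)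
  then have "to_fract n = R * to_fract d" by simp
  then have "to_fract n * to_fract q = to_fract p * to_fract d"
    by (simp only: assms[symmetric] mult_ac)
  then have "to_fract (n * q) = to_fract (p * d)" by simp
  then have "n * q = p * d" by (simp only: to_fract_eq_iff)
  then have "cpoly (n * q) = cpoly (p * d)" by simp
  then show ?thesis
    by (simp add: cpoly_hom.hom_mult n_def d_def rat_num_def rat_den_def)
qed

text \<open>The coefficient map \<open>h\<close> lets one formula serve over real polynomials,
  rational functions and complex numbers. Being free of division, it makes sense in all three and
  also at \<open>y = 0\<close>.\<close>

definition homogenization :: "('a \<Rightarrow> 'b) \<Rightarrow> 'a::zero poly \<Rightarrow> 'b \<Rightarrow> 'b \<Rightarrow> 'b::comm_ring_1" where
  "homogenization h g x y = (\<Sum>i\<le>degree g. h (coeff g i) * x ^ i * y ^ (degree g - i))"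

lemma homogenization_eq_poly:
  fixes h :: "'a::idom \<Rightarrow> 'b::field"
  assumes "inj_comm_ring_hom h" and y: "y \<noteq> 0"
  shows "homogenization h g x y = y ^ degree g * poly (map_poly h g) (x / y)"
proof -
  interpret inj_comm_ring_hom h by fact
  have "poly (map_poly h g) (x / y) = (\<Sum>i\<le>degree g. h (coeff g i) * (x / y) ^ i)"
    by (simp add: poly_altdef)
  then show ?thesis
    unfolding homogenization_def
    by (simp add: sum_distrib_left) (rule sum.cong, use y in \<open>auto simp: field_simps power_diff\<close>)
qed

lemma homogenization_0_right: "homogenization h g x 0 = h (lead_coeff g) * x ^ degree g"
proof -
  have "homogenization h g x 0 = (\<Sum>i\<le>degree g. if i = degree g then h (lead_coeff g) * x ^ degree g else 0)"
    unfolding homogenization_def by (rule sum.cong) (auto simp: power_0_left)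
  then show ?thesis by simp
qed

lemma to_fract_power: "to_fract (x ^ n) = to_fract x ^ n"
  by (induction n) simp_all

lemma to_fract_homogenization:
  "to_fract (homogenization (\<lambda>c. [:c:]) g x y) = homogenization rat_const g (to_fract x) (to_fract y)"
  unfolding homogenization_def rat_const_def to_fract_sum to_fract_mult to_fract_power ..

lemma poly_cpoly_homogenization:
  "poly (cpoly (homogenization (\<lambda>c. [:c:]) g x y)) s =
    homogenization complex_of_real g (poly (cpoly x) s) (poly (cpoly y) s)"
  unfolding homogenization_def
  by (simp add: cpoly_hom.hom_sum cpoly_hom.hom_mult cpoly_hom.hom_power of_real_hom.map_poly_hom_smult poly_sum mult.assoc)

text \<open>Pull \<open>H\<close> out of each of the \<open>n\<close> rows: 1 - H A = H ((1 / H) 1 -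
  A).\<close>

lemma det_one_minus_smult:
  fixes A :: "'a::field mat"
  assumes A: "A \<in> carrier_mat n n" and H: "H \<noteq> 0"
  shows "det (1\<^sub>m n - H \<cdot>\<^sub>m A) = H ^ n * poly (char_poly A) (1 / H)"
proof -
  have "1\<^sub>m n - H \<cdot>\<^sub>m A = H \<cdot>\<^sub>m (- char_matrix A (1 / H))"
    using A H by (intro eq_matI) (auto simp: char_matrix_def field_simps)
  moreover have "dim_col (- char_matrix A (1 / H)) = n"
    using A by (simp add: char_matrix_def)
  ultimately show ?thesis
    using char_poly_matrix[OF A, of "1 / H"] by simp
qed

text \<open>The factor \<open>[:0, 1:] ^ m\<close> contributes
  \<open>H ^ m * (1 / H) ^ m = 1\<close>, so only \<open>H ^ degree g\<close> remains, and
  multiplying by \<open>b ^ degree g\<close> clears its denominator. The result has the shape that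
  \<open>rat_num_den_cross\<close> expects.\<close>

lemma det_one_minus_smult_const:
  assumes Q: "Q \<in> carrier_mat n n" and cp: "char_poly Q = [:0, 1:] ^ m * g"
    and g: "g \<noteq> 0" and H: "H = to_fract a / to_fract b" and ab: "a \<noteq> 0" "b \<noteq> 0"
  shows "det (1\<^sub>m n - H \<cdot>\<^sub>m map_mat rat_const Q) * to_fract (b ^ degree g)
    = to_fract (homogenization (\<lambda>c. [:c:]) g b a)"
proof -
  interpret rc: map_poly_comm_ring_hom rat_const ..
  have H0: "H \<noteq> 0" using H ab by simp
  have "degree (char_poly Q) = n" using degree_monic_char_poly[OF Q] by simp
  then have n: "n = m + degree g"
    using g by (simp add: cp degree_mult_eq degree_power_eq)
  have Q': "map_mat rat_const Q \<in> carrier_mat n n" using Q by simp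
  have "map_poly rat_const [:0, 1:] = [:0, 1:]" by (simp add: map_poly_pCons)
  then have "poly (char_poly (map_mat rat_const Q)) (1 / H) = (1 / H) ^ m * poly (map_poly rat_const g) (1 / H)"
    by (simp add: rat_const_hom.char_poly_hom[OF Q] cp rc.hom_mult rc.hom_power)
  then have "det (1\<^sub>m n - H \<cdot>\<^sub>m map_mat rat_const Q) = H ^ degree g * poly (map_poly rat_const g) (1 / H)"
    using H0 unfolding det_one_minus_smult[OF Q' H0] by (simp add: n power_add power_divide)
  also have "1 / H = to_fract b / to_fract a" by (simp add: H)
  also have "H ^ degree g * poly (map_poly rat_const g) (to_fract b / to_fract a) * to_fract (b ^ degree g)
    = to_fract a ^ degree g * poly (map_poly rat_const g) (to_fract b / to_fract a)"
    using ab by (simp add: H power_divide to_fract_power)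
  also have "\<dots> = homogenization rat_const g (to_fract b) (to_fract a)"
    using ab by (simp add: homogenization_eq_poly rat_const_hom.inj_comm_ring_hom_axioms)
  finally show ?thesis by (simp add: to_fract_homogenization)
qed

lemma stable_system_if_no_eigenvalue_value:
  assumes Q: "Q \<in> carrier_mat n n" and H: "H \<noteq> 0"
    and ev: "\<And>\<mu>. eigenvalue (map_mat complex_of_real Q) \<mu> \<Longrightarrow> \<mu> \<noteq> 0 \<Longrightarrow>
      \<mu> \<notin> finite_values_on (1 / H) closed_right_half_plane"
  shows "stable_system H Q"
  unfolding stable_system_def
proof (intro ballI notI)
  fix s assume s: "s \<in> closed_right_half_plane"
  define D where "D = det (1\<^sub>m n - H \<cdot>\<^sub>m map_mat rat_const Q)"
  assume "rat_zero (det (1\<^sub>m (dim_row Q) - H \<cdot>\<^sub>m map_mat rat_const Q)) s"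
  then have num0: "poly (rat_num D) s = 0"
    using Q by (simp add: rat_zero_def D_def)
  then have den: "poly (rat_den D) s \<noteq> 0" using rat_num_den_no_common_zero by blast
  define a b where "a = fst (quot_of_fract H)" and "b = snd (quot_of_fract H)"
  have Hab: "H = to_fract a / to_fract b" and ab: "a \<noteq> 0" "b \<noteq> 0"
    using H by (simp_all add: a_def b_def flip: Fract_conv_to_fract)
  define z w where "z = poly (cpoly a) s" and "w = poly (cpoly b) s"
  have zw: "\<not> (z = 0 \<and> w = 0)"
    using rat_num_den_no_common_zero[of H s] by (auto simp: z_def w_def a_def b_def rat_num_def rat_den_def)
  have monic: "monic (char_poly Q)" using degree_monic_char_poly[OF Q] by simp
  then have "char_poly Q \<noteq> 0" by auto
  then obtain g m where cp: "char_poly Q = [:0, 1:] ^ m * g" and "\<not> [:0, 1:] dvd g"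
    using order_decomp[of "char_poly Q" 0] by auto
  then have g0: "poly g 0 \<noteq> 0" using poly_eq_0_iff_dvd[of g 0] by simp
  then have "g \<noteq> 0" by auto
  have "lead_coeff g = 1"
    using monic by (simp add: cp lead_coeff_mult lead_coeff_power)
  have "rat_num D * cpoly (b ^ degree g) = cpoly (homogenization (\<lambda>c. [:c:]) g b a) * rat_den D"
    by (rule rat_num_den_cross) (simp only: D_def det_one_minus_smult_const[OF Q cp \<open>g \<noteq> 0\<close> Hab ab])
  then have "poly (rat_num D * cpoly (b ^ degree g)) s = poly (cpoly (homogenization (\<lambda>c. [:c:]) g b a) * rat_den D) s"
    by simp
  \<comment> \<open>The left side vanishes with the reduced numerator of \<open>D\<close>, and on
    the right the reduced denominator is nonzero at \<open>s\<close>.\<close>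
  then have hom0: "homogenization complex_of_real g w z = 0"
    using num0 den by (simp add: poly_cpoly_homogenization z_def w_def)
  \<comment> \<open>At \<open>z = 0\<close> the homogenization would be \<open>w ^ degree g\<close>,
    forcing \<open>w = 0\<close> against \<open>zw\<close>.\<close>
  have z: "z \<noteq> 0"
    using hom0 zw by (auto simp: homogenization_0_right \<open>lead_coeff g = 1\<close>)
  define \<mu> where "\<mu> = w / z"
  have root: "poly (cpoly g) \<mu> = 0"
    using hom0 z homogenization_eq_poly[OF of_real_hom.inj_comm_ring_hom_axioms z, of g w] by (simp add: \<mu>_def)
  then have "poly (cpoly (char_poly Q)) \<mu> = 0" by (simp add: cp cpoly_hom.hom_mult)
  then have eigen: "eigenvalue (map_mat complex_of_real Q) \<mu>"
    using Q by (simp add: eigenvalue_root_char_poly[of _ n] of_real_hom.char_poly_hom[OF Q])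
  have "poly (cpoly g) 0 = complex_of_real (poly g 0)"
    by (simp add: poly_0_coeff_0)
  then have "\<mu> \<noteq> 0" using root g0 by auto
  \<comment> \<open>The reduced form of \<open>1 / H\<close> need not be literally the pair
    \<open>(b, a)\<close>, so its value at \<open>s\<close> is obtained by
    cross-multiplication.\<close>
  have "1 / H * to_fract a = to_fract b" using ab by (simp add: Hab)
  from arg_cong[OF rat_num_den_cross[OF this], of "\<lambda>p. poly p s"]
  have cross: "poly (rat_num (1 / H)) s * z = w * poly (rat_den (1 / H)) s"
    by (simp add: z_def w_def)
  \<comment> \<open>At a pole, \<open>cross\<close> and \<open>z \<noteq> 0\<close> would make the
    numerator of \<open>1 / H\<close> vanish as well.\<close>
  have "\<not> rat_pole (1 / H) s"
    using cross z rat_num_den_no_common_zero[of "1 / H" s] by (auto simp: rat_pole_def)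
  moreover from this have "rat_eval (1 / H) s = \<mu>"
    using cross z by (simp add: rat_eval_def \<mu>_def rat_pole_def field_simps)
  ultimately have "\<mu> \<in> finite_values_on (1 / H) closed_right_half_plane"
    using s by (auto simp: finite_values_on_def)
  with ev[OF eigen \<open>\<mu> \<noteq> 0\<close>] show False by simp
qed

theorem theorem6:
  fixes N :: nat
    and t :: "nat \<Rightarrow> nat \<Rightarrow> real"
    and T Q :: "real mat"
    and H\<^sub>n \<phi>\<^sub>n :: real_rational
    and \<Omega>\<^sub>p :: "complex set"
  assumes t_sym: "\<And>i j. i < N \<Longrightarrow> j < N \<Longrightarrow> i \<noteq> j \<Longrightarrow> t i j = t j i"
    and t_nonneg: "\<And>i j. i < N \<Longrightarrow> j < N \<Longrightarrow> i \<noteq> j \<Longrightarrow> t i j \<ge> 0"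
    and T_dim: "T \<in> carrier_mat N N"
    and T_off: "\<And>i j. i < N \<Longrightarrow> j < N \<Longrightarrow> i \<noteq> j \<Longrightarrow> T $$ (i, j) = - t i j"
    and T_diag: "\<And>i. i < N \<Longrightarrow> T $$ (i, i) = (\<Sum>j\<in>{..<N} - {i}. t i j)"
    and Q: "Q = - T"
    and H_nonzero: "H\<^sub>n \<noteq> 0"
    and H_strictly_proper: "strictly_proper H\<^sub>n"
    and phi: "\<phi>\<^sub>n = 1 / H\<^sub>n"
    and Omega: "\<Omega>\<^sub>p = finite_values_on \<phi>\<^sub>n closed_right_half_plane"
    and eigenvalues: "\<And>\<mu>. eigenvalue (map_mat complex_of_real Q) \<mu> \<Longrightarrow> \<mu> \<noteq> 0 \<Longrightarrow> \<mu> \<in> - \<Omega>\<^sub>p"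
  shows "stable_system H\<^sub>n Q"
  using stable_system_if_no_eigenvalue_value[of Q N H\<^sub>n] T_dim eigenvalues H_nonzero
  by (auto simp: Q phi Omega)

end
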